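(* For all integers $n\geq 1$ and $p\geq 0$, $$\mathcal{A}(P_{n}\cup (p+1)K_1)<\mathcal{A}(P_{n+1}\cup pK_1).$$
   Context: Graphs are finite and simple. For a graph $G$ and an integer $k$, $S(G,k)$ is the number of partitions of the vertex set of $G$ into exactly $k$ nonempty stable sets (sets of pairwise non-adjacent vertices). Put $\mathcal{B}(G)=\sum_{k}S(G,k)$, $\mathcal{T}(G)=\sum_{k}k\,S(G,k)$ and $\mathcal{A}(G)=\mathcal{T}(G)/\mathcal{B}(G)$ (the average number of colors in the non-equivalent colorings of $G$). $P_n$ is the path on $n$ vertices, and $G\cup pK_1$ is the graph obtained from $G$ by adding $p$ isolated vertices. *)

theory Defs
  imports Complex_Main "HOL-Library.Disjoint_Sets" "Graph_Theory.Pair_Digraph"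
begin

text \<open>
  A finite simple graph is a \<^locale>\<open>pair_graph\<close>: a loop-free symmetric digraph on finitely many
  vertices, each undirected edge being the pair of its two orientations.
\<close>

definition stable_set :: "'a pair_pre_digraph \<Rightarrow> 'a set \<Rightarrow> bool" where
  "stable_set G X \<longleftrightarrow> X \<subseteq> pverts G \<and> (\<forall>u\<in>X. \<forall>v\<in>X. (u, v) \<notin> parcs G)"

definition stable_partitions :: "'a pair_pre_digraph \<Rightarrow> nat \<Rightarrow> 'a set set set" where
  "stable_partitions G k =
    {P. partition_on (pverts G) P \<and> card P = k \<and> (\<forall>X\<in>P. stable_set G X)}"

definition num_stable_partitions :: "'a pair_pre_digraph \<Rightarrow> nat \<Rightarrow> nat" where
  "num_stable_partitions G k = card (stable_partitions G k)"

text \<open>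
  The sums over all \<open>k\<close> may stop at the number of vertices; see
  \<open>num_stable_partitions_eq_0\<close> below.
\<close>

definition total_colorings :: "'a pair_pre_digraph \<Rightarrow> nat" where
  "total_colorings G = (\<Sum>k\<le>card (pverts G). num_stable_partitions G k)"

definition total_colors :: "'a pair_pre_digraph \<Rightarrow> nat" where
  "total_colors G = (\<Sum>k\<le>card (pverts G). k * num_stable_partitions G k)"

definition avg_colors :: "'a pair_pre_digraph \<Rightarrow> real" where
  "avg_colors G = real (total_colors G) / real (total_colorings G)"

definition path_graph :: "nat \<Rightarrow> nat pair_pre_digraph" where
  "path_graph n =
    \<lparr> pverts = {..<n}, parcs = {(i, j). i < n \<and> j < n \<and> (j = Suc i \<or> i = Suc j)} \<rparr>"

definition add_isolated :: "'a pair_pre_digraph \<Rightarrow> nat \<Rightarrow> ('a + nat) pair_pre_digraph" where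
  "add_isolated G p =
    \<lparr> pverts = pverts G <+> {..<p}, parcs = map_prod Inl Inl ` parcs G \<rparr>"

lemma pair_graph_path_graph: "pair_graph (path_graph n)"
proof -
  have "finite (parcs (path_graph n))"
    by (rule finite_subset[of _ "{..<n} \<times> {..<n}"]) (auto simp: path_graph_def)
  then show ?thesis
    by unfold_locales (auto simp: path_graph_def symmetric_def intro!: symI)
qed

lemma pair_graph_add_isolated:
  assumes "pair_graph G"
  shows "pair_graph (add_isolated G p)"
proof -
  interpret G: pair_graph G by fact
  have "sym (parcs G)"
    using G.pair_sym_arcs by (simp add: symmetric_def)
  then have "sym (map_prod Inl Inl ` parcs G)"
    by (auto simp: sym_def)
  moreover have "finite (parcs (add_isolated G p))"
    using G.pair_finite_arcs by (simp add: add_isolated_def)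
  ultimately show ?thesis
    using G.pair_finite_verts
    by unfold_locales
      (auto simp: add_isolated_def symmetric_def dest: G.in_arcsD1 G.in_arcsD2 G.pair_no_loops)
qed

lemma finite_stable_partitions:
  assumes "finite (pverts G)"
  shows "finite (stable_partitions G k)"
  using finitely_many_partition_on[OF assms]
  by (rule rev_finite_subset) (auto simp: stable_partitions_def)

lemma card_partition_on_le:
  assumes "finite A" and "partition_on A P"
  shows "card P \<le> card A"
proof -
  have P: "\<Union>P = A" "disjoint P" "{} \<notin> P"
    using assms(2) by (auto simp: partition_on_def)
  have "\<forall>X\<in>P. \<exists>x. x \<in> X"
    using P(3) by (metis all_not_in_conv)
  then obtain f where f: "\<forall>X\<in>P. f X \<in> X"
    by metis
  have "inj_on f P"
    using f P(2) unfolding inj_on_def disjoint_def by (metis disjoint_iff)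
  moreover have "f ` P \<subseteq> A"
    using f P(1) by auto
  ultimately show ?thesis
    using assms(1) by (rule card_inj_on_le)
qed

lemma num_stable_partitions_eq_0:
  assumes "finite (pverts G)" and "k > card (pverts G)"
  shows "num_stable_partitions G k = 0"
proof -
  have "stable_partitions G k = {}"
    using card_partition_on_le[OF assms(1)] assms(2)
    by (fastforce simp: stable_partitions_def)
  then show ?thesis
    by (simp add: num_stable_partitions_def)
qed

end

theory Submission
  imports Defs
begin

text \<open>
  The number of proper \<open>m\<close>-colorings of \<open>G\<close> is \<open>\<pi>(m) = \<Sum>k. S(G,k) m(m-1)\<cdots>(m-k+1)\<close>, so as in Dobinski's
  formula \<open>\<Sum>m. \<pi>(m)/m! = e \<B>(G)\<close> and \<open>\<Sum>m. m \<pi>(m)/m! = e (\<T>(G) + \<B>(G))\<close>: up to a shift by one,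
  \<open>\<A>(G)\<close> is the mean of \<open>m\<close> under the weights \<open>\<pi>(m)/m!\<close>. For \<open>P\<^sub>n \<union> pK\<^sub>1\<close> one has
  \<open>\<pi>(m) = m\<^bsup>p+1\<^esup>(m-1)\<^bsup>n-1\<^esup>\<close>. If \<open>M\<^sub>i\<close> are the moments of the weights \<open>m\<^bsup>p+1\<^esup>(m-1)\<^bsup>n-1\<^esup>/m!\<close>, the claim
  reads \<open>M\<^sub>2/M\<^sub>1 < (M\<^sub>2 - M\<^sub>1)/(M\<^sub>1 - M\<^sub>0)\<close>, which is the strict Cauchy-Schwarz inequality
  \<open>M\<^sub>1\<^sup>2 < M\<^sub>0 M\<^sub>2\<close>.
\<close>

section \<open>Colorings grouped by their kernel partition\<close>

text \<open>This is the kernel partition of \<open>c\<close> on \<open>A\<close>; indexing by points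
  of \<open>A\<close> rather than by values keeps empty fibres out.\<close>

definition fibres :: "'a set \<Rightarrow> ('a \<Rightarrow> 'b) \<Rightarrow> 'a set set" where
  "fibres A c = (\<lambda>x. {y \<in> A. c y = c x}) ` A"

lemma partition_on_fibres: "partition_on A (fibres A c)"
  by (rule partition_onI) (auto simp: fibres_def disjnt_def)

text \<open>A function with kernel partition \<open>P\<close> amounts to a choice of distinct values
  for the blocks of \<open>P\<close>. For finite \<open>P\<close> and \<open>C\<close> the
  right-hand side is a falling factorial.\<close>

lemma card_funcset_fibres_eq:
  assumes P: "partition_on A P"
  shows "card {c \<in> A \<rightarrow>\<^sub>E C. fibres A c = P} = card {g \<in> P \<rightarrow>\<^sub>E C. inj_on g P}"
proof -
  \<comment> \<open>\<open>b v\<close> is the block of \<open>P\<close> containing \<open>v\<close>,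
    so \<open>b\<close> is the quotient map from \<open>A\<close> onto \<open>P\<close>.\<close>
  define b where "b v = (THE X. X \<in> P \<and> v \<in> X)" for v
  have U: "\<Union>P = A" and ne: "\<And>X. X \<in> P \<Longrightarrow> X \<noteq> {}"
    using P by (auto simp: partition_on_def)
  have eq: "X = Y" if "X \<in> P" "Y \<in> P" "v \<in> X" "v \<in> Y" for X Y v
    using P that by (auto simp: partition_on_def disjoint_def)
  have b: "b v = X" if "X \<in> P" "v \<in> X" for v X
    unfolding b_def by (rule the_equality) (use that eq in auto)
  have bP: "b v \<in> P" "v \<in> b v" if v: "v \<in> A" for v
  proof -
    obtain X where "X \<in> P" "v \<in> X"
      using U v by blast
    then show "b v \<in> P" "v \<in> b v"
      by (simp_all add: b)
  qed
  have bXY: "b v = b w \<longleftrightarrow> w \<in> b v" if "v \<in> A" "w \<in> A" for v w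
    using that b[of "b v" w] bP[of v] bP[of w] by auto
  \<comment> \<open>\<open>F\<close> descends a function to the blocks and \<open>H\<close> pulls a
    labelling back along \<open>b\<close>. The use of \<open>the_elem\<close> is justified by
    \<open>Fb\<close>: when \<open>fibres A c = P\<close>, \<open>c\<close> is constant on each
    block.\<close>
  define F where "F c = restrict (\<lambda>X. the_elem (c ` X)) P" for c :: "'a \<Rightarrow> 'b"
  define H where "H g = restrict (\<lambda>v. g (b v)) A" for g :: "'a set \<Rightarrow> 'b"
  have fib: "c w = c v \<longleftrightarrow> w \<in> b v" if c: "fibres A c = P" "v \<in> A" "w \<in> A" for c :: "'a \<Rightarrow> 'b" and v w
  proof -
    have "{y \<in> A. c y = c v} \<in> P"
      using c by (auto simp: fibres_def)
    then have "b v = {y \<in> A. c y = c v}"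
      using c by (intro b) auto
    then show ?thesis using c by auto
  qed
  have Fb: "F c (b v) = c v" if c: "fibres A c = P" "v \<in> A" for c v
  proof -
    have "b v \<subseteq> A"
      using bP(1)[OF c(2)] U by blast
    then have "c w = c v" if "w \<in> b v" for w
      using fib[OF c] that by blast
    then have "c ` b v = {c v}"
      using bP(2)[OF c(2)] by blast
    then show ?thesis by (simp add: F_def bP[OF c(2)])
  qed
  have P_b: "P = b ` A"
  proof
    show "P \<subseteq> b ` A"
    proof
      fix X assume X: "X \<in> P"
      then obtain v where "v \<in> X" using ne by blast
      then show "X \<in> b ` A" using X U b by blast
    qed
  qed (use bP in blast)
  \<comment> \<open>Injectivity of \<open>g\<close> prevents different blocks from merging into one
    fibre.\<close>
  have fibH: "fibres A (H g) = P" if g: "inj_on g P" for g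
  proof -
    have "{y \<in> A. H g y = H g x} = b x" if x: "x \<in> A" for x
    proof -
      have "H g y = H g x \<longleftrightarrow> y \<in> b x" if "y \<in> A" for y
        using that x inj_on_eq_iff[OF g bP(1) bP(1)] bXY[OF x that] by (auto simp: H_def)
      moreover have "b x \<subseteq> A"
        using bP(1)[OF x] U by blast
      ultimately show ?thesis by blast
    qed
    then show ?thesis by (simp add: fibres_def P_b)
  qed
  have "bij_betw F {c \<in> A \<rightarrow>\<^sub>E C. fibres A c = P} {g \<in> P \<rightarrow>\<^sub>E C. inj_on g P}"
  proof (rule bij_betw_byWitness[where f' = H])
    show "\<forall>c\<in>{c \<in> A \<rightarrow>\<^sub>E C. fibres A c = P}. H (F c) = c"
    proof
      fix c assume "c \<in> {c \<in> A \<rightarrow>\<^sub>E C. fibres A c = P}"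
      then have c: "c \<in> A \<rightarrow>\<^sub>E C" "fibres A c = P" by auto
      have "H (F c) v = c v" if "v \<in> A" for v
        using that by (simp add: H_def Fb[OF c(2)])
      moreover have "H (F c) v = c v" if "v \<notin> A" for v
        using that by (simp add: H_def PiE_arb[OF c(1)])
      ultimately show "H (F c) = c" by blast
    qed
    show "\<forall>g\<in>{g \<in> P \<rightarrow>\<^sub>E C. inj_on g P}. F (H g) = g"
    proof safe
      fix g assume g: "g \<in> P \<rightarrow>\<^sub>E C" "inj_on g P"
      show "F (H g) = g"
      proof
        fix X
        show "F (H g) X = g X"
        proof (cases "X \<in> P")
          case True
          then obtain v where v: "v \<in> A" "X = b v" using P_b by auto
          have "F (H g) (b v) = H g v" by (rule Fb[OF fibH[OF g(2)] v(1)])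
          then show ?thesis using v by (simp add: H_def)
        next
          case False
          then show ?thesis by (simp add: F_def PiE_arb[OF g(1)])
        qed
      qed
    qed
    show "F ` {c \<in> A \<rightarrow>\<^sub>E C. fibres A c = P} \<subseteq> {g \<in> P \<rightarrow>\<^sub>E C. inj_on g P}"
    proof (rule image_subsetI)
      fix c assume "c \<in> {c \<in> A \<rightarrow>\<^sub>E C. fibres A c = P}"
      then have c: "c \<in> A \<rightarrow>\<^sub>E C" "fibres A c = P" by auto
      have "F c X \<in> C" if X: "X \<in> P" for X
      proof -
        obtain v where v: "v \<in> A" "X = b v" using X P_b by auto
        then show ?thesis using Fb[OF c(2) v(1)] PiE_mem[OF c(1) v(1)] by simp
      qed
      then have "F c \<in> P \<rightarrow>\<^sub>E C" by (simp add: F_def)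
      moreover have "inj_on (F c) P"
      proof (rule inj_onI)
        fix X Y assume XY: "X \<in> P" "Y \<in> P" "F c X = F c Y"
        then obtain v w where vw: "v \<in> A" "X = b v" "w \<in> A" "Y = b w" using P_b by auto
        then have "c w = c v" using Fb[OF c(2)] XY by simp
        then show "X = Y" using fib[OF c(2)] bXY vw by simp
      qed
      ultimately show "F c \<in> {g \<in> P \<rightarrow>\<^sub>E C. inj_on g P}" by blast
    qed
    show "H ` {g \<in> P \<rightarrow>\<^sub>E C. inj_on g P} \<subseteq> {c \<in> A \<rightarrow>\<^sub>E C. fibres A c = P}"
    proof (rule image_subsetI)
      fix g assume "g \<in> {g \<in> P \<rightarrow>\<^sub>E C. inj_on g P}"
      then have g: "g \<in> P \<rightarrow>\<^sub>E C" "inj_on g P" by auto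
      have "H g \<in> A \<rightarrow>\<^sub>E C"
        using PiE_mem[OF g(1) bP(1)] by (simp add: H_def)
      then show "H g \<in> {c \<in> A \<rightarrow>\<^sub>E C. fibres A c = P}"
        using fibH[OF g(2)] by simp
    qed
  qed
  then show ?thesis by (rule bij_betw_same_card)
qed

definition colorings :: "'a pair_pre_digraph \<Rightarrow> nat \<Rightarrow> ('a \<Rightarrow> nat) set" where
  "colorings G m = {c \<in> pverts G \<rightarrow>\<^sub>E {..<m}.
    \<forall>u\<in>pverts G. \<forall>v\<in>pverts G. (u, v) \<in> parcs G \<longrightarrow> c u \<noteq> c v}"

text \<open>A coloring is proper exactly when all its fibres are stable, so proper colorings are
  sorted by their kernel partition. The product is the falling factorial: for \<open>m < k\<close>
  it contains the factor 0.\<close>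

lemma card_colorings_eq_sum:
  assumes fin: "finite (pverts G)"
  shows "card (colorings G m) =
    (\<Sum>k\<le>card (pverts G). num_stable_partitions G k * (\<Prod>i<k. m - i))"
proof -
  define N where "N = card (pverts G)"
  define W where "W P = {c \<in> pverts G \<rightarrow>\<^sub>E {..<m}. fibres (pverts G) c = P}" for P
  have W: "card (W P) = (\<Prod>i<k. m - i)" if "P \<in> stable_partitions G k" for P k
  proof -
    have P: "partition_on (pverts G) P" "card P = k"
      using that by (auto simp: stable_partitions_def)
    moreover have "finite P"
      using P(1) fin finite_elements by blast
    ultimately show ?thesis
      by (simp add: W_def card_funcset_fibres_eq card_inj_on_subset_funcset atLeast0LessThan)
  qed
  have finW: "finite (W P)" for P
    by (rule finite_subset[of _ "pverts G \<rightarrow>\<^sub>E {..<m}"]) (auto simp: W_def fin intro: finite_PiE)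
  have "colorings G m = (\<Union>P\<in>(\<Union>k\<le>N. stable_partitions G k). W P)" (is "?L = ?R")
  proof
    show "?L \<subseteq> ?R"
    proof
      fix c assume c: "c \<in> ?L"
      let ?P = "fibres (pverts G) c"
      have "\<forall>X\<in>?P. stable_set G X"
        using c by (fastforce simp: fibres_def stable_set_def colorings_def)
      then have "?P \<in> stable_partitions G (card ?P)"
        by (simp add: stable_partitions_def partition_on_fibres)
      moreover have "card ?P \<le> N"
        unfolding N_def using fin by (intro card_partition_on_le partition_on_fibres)
      ultimately show "c \<in> ?R"
        using c by (auto simp: W_def colorings_def)
    qed
    show "?R \<subseteq> ?L"
      by (fastforce simp: W_def colorings_def stable_partitions_def stable_set_def fibres_def)
  qed
  \<comment> \<open>The sets \<open>W P\<close> are disjoint because a coloring has only one kernel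
    partition; below, the partitions for different \<open>k\<close> are told apart by their number
    of blocks.\<close>
  also have "card \<dots> = (\<Sum>P\<in>(\<Union>k\<le>N. stable_partitions G k). card (W P))"
    by (rule card_UN_disjoint) (auto simp: finW finite_stable_partitions[OF fin], auto simp: W_def)
  also have "\<dots> = (\<Sum>k\<le>N. \<Sum>P\<in>stable_partitions G k. card (W P))"
    by (rule sum.UNION_disjoint) (auto simp: finite_stable_partitions[OF fin], auto simp: stable_partitions_def)
  also have "\<dots> = (\<Sum>k\<le>N. num_stable_partitions G k * (\<Prod>i<k. m - i))"
    by (intro sum.cong refl) (simp add: W num_stable_partitions_def)
  finally show ?thesis by (simp add: N_def)
qed

section \<open>Dobinski-type series\<close>

lemma prod_diff_mult_fact: "(\<Prod>i<k. j + k - i) * fact j = (fact (j + k) :: nat)"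
proof (induction k arbitrary: j)
  case (Suc k)
  have "(\<Prod>i<Suc k. j + Suc k - i) * fact j = (\<Prod>i<k. Suc j + k - i) * fact (Suc j)"
    by (simp add: algebra_simps)
  also have "\<dots> = fact (j + Suc k)"
    using Suc.IH[of "Suc j"] by simp
  finally show ?case .
qed simp

lemma prod_diff_eq_0: "m < k \<Longrightarrow> (\<Prod>i<k. m - i) = (0::nat)"
  by (rule prod_zero) auto

lemma prod_diff_div_fact: "real (\<Prod>i<k. j + k - i) / fact (j + k) = 1 / fact j"
proof -
  have "real (\<Prod>i<k. j + k - i) * fact j = fact (j + k)"
    using arg_cong[OF prod_diff_mult_fact[of j k], of real] by simp
  then show ?thesis by (simp add: field_simps)
qed

lemma sums_inverse_fact: "(\<lambda>j. 1 / fact j) sums exp (1::real)"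
  using exp_converges[of "1::real"] by (simp add: scaleR_conv_of_real field_simps)

lemma sums_id_div_fact: "(\<lambda>j. real j / fact j) sums exp 1"
proof -
  have "real (Suc j) / fact (Suc j) = 1 / fact j" for j
    unfolding fact_Suc by (simp del: of_nat_Suc)
  then show ?thesis
    using sums_Suc_imp[of "\<lambda>j. real j / fact j" "exp 1"] sums_inverse_fact by simp
qed

text \<open>The first \<open>k\<close> terms vanish, and dropping them leaves the exponential series
  at 1.\<close>

lemma sums_falling: "(\<lambda>m. real (\<Prod>i<k. m - i) / fact m) sums exp 1"
proof (subst sums_zero_iff_shift[symmetric, of k])
  show "(\<lambda>j. real (\<Prod>i<k. j + k - i) / fact (j + k)) sums exp 1"
    unfolding prod_diff_div_fact by (rule sums_inverse_fact)
qed (simp only: prod_diff_eq_0 of_nat_0 div_0)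

text \<open>After the shift by \<open>k\<close> the extra factor is \<open>j + k\<close>: the part
  \<open>j\<close> contributes \<open>exp 1\<close> and the constant part
  \<open>k * exp 1\<close>.\<close>

lemma sums_id_times_falling:
  "(\<lambda>m. real m * (real (\<Prod>i<k. m - i) / fact m)) sums (exp 1 * (1 + real k))"
proof (subst sums_zero_iff_shift[symmetric, of k])
  have "(\<lambda>j. real j / fact j + real k * (1 / fact j)) sums (exp 1 + real k * exp 1)"
    by (intro sums_add sums_mult sums_id_div_fact sums_inverse_fact)
  moreover have "real (j + k) * (1 / fact j) = real j / fact j + real k * (1 / fact j)" for j
    by (simp add: add_divide_distrib)
  ultimately show "(\<lambda>j. real (j + k) * (real (\<Prod>i<k. j + k - i) / fact (j + k)))
      sums (exp 1 * (1 + real k))"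
    unfolding prod_diff_div_fact by (simp add: algebra_simps)
qed (simp only: prod_diff_eq_0 of_nat_0 div_0 mult_zero_right)

text \<open>The coloring count is a finite combination of falling factorials, each of which
  contributes the same value \<open>exp 1\<close>; hence only the sum of the coefficients
  survives.\<close>

lemma sums_colorings:
  assumes "finite (pverts G)"
  shows "(\<lambda>m. real (card (colorings G m)) / fact m) sums (exp 1 * real (total_colorings G))"
proof -
  have "(\<lambda>m. \<Sum>k\<le>card (pverts G). real (num_stable_partitions G k) *
      (real (\<Prod>i<k. m - i) / fact m))
    sums (\<Sum>k\<le>card (pverts G). real (num_stable_partitions G k) * exp 1)"
    by (intro sums_sum sums_mult sums_falling)
  moreover have "real (card (colorings G m)) / fact m =
      (\<Sum>k\<le>card (pverts G). real (num_stable_partitions G k) * (real (\<Prod>i<k. m - i) / fact m))" for m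
    by (simp only: card_colorings_eq_sum[OF assms] of_nat_sum of_nat_mult sum_divide_distrib
        times_divide_eq_right)
  moreover have "exp 1 * real (total_colorings G) =
      (\<Sum>k\<le>card (pverts G). real (num_stable_partitions G k) * exp 1)"
    by (simp only: total_colorings_def of_nat_sum sum_distrib_left mult.commute)
  ultimately show ?thesis by simp
qed

text \<open>Here the falling factorial of order \<open>k\<close> contributes
  \<open>exp 1 * (1 + k)\<close>, which brings in \<open>total_colors\<close> besides
  \<open>total_colorings\<close>.\<close>

lemma sums_id_times_colorings:
  assumes "finite (pverts G)"
  shows "(\<lambda>m. real m * (real (card (colorings G m)) / fact m))
    sums (exp 1 * (real (total_colorings G) + real (total_colors G)))"
proof -
  have "(\<lambda>m. \<Sum>k\<le>card (pverts G). real (num_stable_partitions G k) *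
      (real m * (real (\<Prod>i<k. m - i) / fact m)))
    sums (\<Sum>k\<le>card (pverts G). real (num_stable_partitions G k) * (exp 1 * (1 + real k)))"
    by (intro sums_sum sums_mult sums_id_times_falling)
  moreover have "real m * (real (card (colorings G m)) / fact m) =
      (\<Sum>k\<le>card (pverts G). real (num_stable_partitions G k) *
        (real m * (real (\<Prod>i<k. m - i) / fact m)))" for m
    by (simp only: card_colorings_eq_sum[OF assms] of_nat_sum of_nat_mult sum_divide_distrib
        sum_distrib_left times_divide_eq_right mult.left_commute)
  moreover have "exp 1 * (real (total_colorings G) + real (total_colors G)) =
      (\<Sum>k\<le>card (pverts G). real (num_stable_partitions G k) * (exp 1 * (1 + real k)))"
    by (simp only: total_colorings_def total_colors_def of_nat_sum of_nat_mult
        sum.distrib[symmetric] sum_distrib_left) (simp add: algebra_simps)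
  ultimately show ?thesis by simp
qed

section \<open>Chromatic polynomials of paths with isolated vertices\<close>

lemma card_colorings_add_isolated:
  assumes "finite (pverts G)"
  shows "card (colorings (add_isolated G p) m) = card (colorings G m) * m ^ p"
proof -
  let ?f = "\<lambda>c. (restrict (c \<circ> Inl) (pverts G), restrict (c \<circ> Inr) {..<p})"
  let ?g = "\<lambda>(d, e). restrict (case_sum d e) (pverts G <+> {..<p})"
  have "bij_betw ?f (colorings (add_isolated G p) m) (colorings G m \<times> ({..<p} \<rightarrow>\<^sub>E {..<m}))"
  proof (rule bij_betw_byWitness[where f' = ?g])
    show "\<forall>c\<in>colorings (add_isolated G p) m. ?g (?f c) = c"
    proof
      fix c assume "c \<in> colorings (add_isolated G p) m"
      then have "c \<in> extensional (pverts G <+> {..<p})"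
        by (auto simp: colorings_def add_isolated_def PiE_def)
      then show "?g (?f c) = c"
        by (auto simp: fun_eq_iff restrict_def extensional_def split: sum.splits)
    qed
    show "\<forall>y\<in>colorings G m \<times> ({..<p} \<rightarrow>\<^sub>E {..<m}). ?f (?g y) = y"
      by (auto simp: colorings_def fun_eq_iff restrict_def PiE_def extensional_def)
    show "?f ` colorings (add_isolated G p) m \<subseteq> colorings G m \<times> ({..<p} \<rightarrow>\<^sub>E {..<m})"
      by (force simp: colorings_def add_isolated_def)
    show "?g ` (colorings G m \<times> ({..<p} \<rightarrow>\<^sub>E {..<m})) \<subseteq> colorings (add_isolated G p) m"
      by (fastforce simp: colorings_def add_isolated_def)
  qed
  then show ?thesis
    by (simp add: bij_betw_same_card card_cartesian_product card_funcsetE)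
qed

lemma mem_colorings_path_graph_iff:
  "c \<in> colorings (path_graph n) m \<longleftrightarrow>
    c \<in> {..<n} \<rightarrow>\<^sub>E {..<m} \<and> (\<forall>i. Suc i < n \<longrightarrow> c i \<noteq> c (Suc i))"
proof -
  have "(\<forall>u\<in>{..<n}. \<forall>v\<in>{..<n}. v = Suc u \<or> u = Suc v \<longrightarrow> c u \<noteq> c v) \<longleftrightarrow>
      (\<forall>i. Suc i < n \<longrightarrow> c i \<noteq> c (Suc i))"
    by (metis Suc_lessD lessThan_iff)
  then show ?thesis
    by (auto simp: colorings_def path_graph_def)
qed

text \<open>Induction on the length: the new end vertex only has to avoid the color of its one
  neighbor. Truncated \<open>m - 1\<close> is harmless at \<open>m = 0\<close>, where the factor
  \<open>m\<close> makes the product 0.\<close>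

lemma card_colorings_path_graph:
  "card (colorings (path_graph (Suc n)) m) = m * (m - 1) ^ n"
proof (induction n)
  case 0
  have "colorings (path_graph (Suc 0)) m = {..<Suc 0} \<rightarrow>\<^sub>E {..<m}"
    by (auto simp: colorings_def path_graph_def)
  then show ?case by (simp add: card_funcsetE)
next
  case (Suc n)
  let ?A = "colorings (path_graph (Suc n)) m"
  have fin: "finite ?A"
    by (rule finite_subset[of _ "{..<Suc n} \<rightarrow>\<^sub>E {..<m}"])
      (auto simp: colorings_def path_graph_def intro: finite_PiE)
  let ?f = "\<lambda>c. (restrict c {..<Suc n}, c (Suc n))"
  let ?g = "\<lambda>(d, i). d(Suc n := i)"
  have "bij_betw ?f (colorings (path_graph (Suc (Suc n))) m) (SIGMA d:?A. {..<m} - {d n})"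
  proof (rule bij_betw_byWitness[where f' = ?g])
    show "\<forall>c\<in>colorings (path_graph (Suc (Suc n))) m. ?g (?f c) = c"
      by (auto simp: mem_colorings_path_graph_iff fun_eq_iff restrict_def PiE_def extensional_def)
    show "\<forall>y\<in>(SIGMA d:?A. {..<m} - {d n}). ?f (?g y) = y"
      by (auto simp: mem_colorings_path_graph_iff fun_eq_iff restrict_def PiE_def extensional_def)
    show "?f ` colorings (path_graph (Suc (Suc n))) m \<subseteq> (SIGMA d:?A. {..<m} - {d n})"
      by (auto simp: mem_colorings_path_graph_iff PiE_iff) (metis lessI)
    show "?g ` (SIGMA d:?A. {..<m} - {d n}) \<subseteq> colorings (path_graph (Suc (Suc n))) m"
      by (auto simp: mem_colorings_path_graph_iff PiE_iff extensional_def less_Suc_eq)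
  qed
  then have "card (colorings (path_graph (Suc (Suc n))) m) = (\<Sum>d\<in>?A. card ({..<m} - {d n}))"
    using fin by (simp add: bij_betw_same_card)
  also have "\<dots> = (\<Sum>d\<in>?A. m - 1)"
  proof (rule sum.cong)
    fix d assume "d \<in> ?A"
    then have "d n \<in> {..<m}" by (auto simp: colorings_def path_graph_def)
    then show "card ({..<m} - {d n}) = m - 1" by (subst card_Diff_singleton) auto
  qed simp
  finally show ?case using Suc.IH by simp
qed

section \<open>Moments and the comparison of averages\<close>

text \<open>The series of \<open>(M0 * m - M1)\<^sup>2 * w m\<close> has sum
  \<open>M0 * (M0 * M2 - M1\<^sup>2)\<close>. Its terms are nonnegative, and one is positive because
  \<open>M0 * m = M1\<close> cannot hold at both \<open>i\<close> and \<open>j\<close>.\<close>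

lemma strict_Cauchy_Schwarz_moments:
  fixes w :: "nat \<Rightarrow> real"
  assumes M0: "w sums M0" and M1: "(\<lambda>m. real m * w m) sums M1"
    and M2: "(\<lambda>m. (real m)\<^sup>2 * w m) sums M2"
    and nonneg: "\<And>m. w m \<ge> 0" and pos: "w i > 0" "w j > 0" "i \<noteq> j"
  shows "M1\<^sup>2 < M0 * M2"
proof -
  have M0_pos: "M0 > 0"
    using suminf_pos2[of w i] M0 nonneg pos by (simp add: sums_iff)
  have "(\<lambda>m. M0\<^sup>2 * ((real m)\<^sup>2 * w m) - 2 * M0 * M1 * (real m * w m) + M1\<^sup>2 * w m)
      sums (M0\<^sup>2 * M2 - 2 * M0 * M1 * M1 + M1\<^sup>2 * M0)"
    by (intro sums_add sums_diff sums_mult M0 M1 M2)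
  then have S: "(\<lambda>m. (M0 * real m - M1)\<^sup>2 * w m) sums (M0 * (M0 * M2 - M1\<^sup>2))"
    by (simp add: power2_eq_square algebra_simps)
  have "M0 * real i \<noteq> M1 \<or> M0 * real j \<noteq> M1"
    using M0_pos pos(3) by (metis less_irrefl mult_left_cancel of_nat_eq_iff)
  then obtain l where "(M0 * real l - M1)\<^sup>2 * w l > 0"
    using pos by (metis eq_iff_diff_eq_0 mult_pos_pos zero_less_power2)
  then have "M0 * (M0 * M2 - M1\<^sup>2) > 0"
    using suminf_pos2[of "\<lambda>m. (M0 * real m - M1)\<^sup>2 * w m" l] S nonneg by (simp add: sums_iff)
  then show ?thesis using M0_pos by (simp add: zero_less_mult_iff)
qed

theorem theorem8:
  fixes n p :: nat
  assumes "n \<ge> 1"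
  shows "avg_colors (add_isolated (path_graph n) (p + 1)) <
    avg_colors (add_isolated (path_graph (n + 1)) p)"
proof -
  obtain k where n: "n = Suc k" using assms by (cases n) auto
  let ?G = "add_isolated (path_graph n)"
  let ?H = "add_isolated (path_graph (n + 1)) p"
  have fin: "finite (pverts (path_graph l))" "finite (pverts (add_isolated (path_graph l) q))" for l q
    by (simp_all add: path_graph_def add_isolated_def)
  \<comment> \<open>All series are expressed through these weights: one more isolated vertex
    multiplies them by \<open>m\<close>, one more path vertex by \<open>m - 1\<close>.\<close>
  define w where "w m = real (card (colorings (?G p) m)) / fact m" for m
  have w: "w m = real (m * (m - 1) ^ k * m ^ p) / fact m" for m
    by (simp add: w_def n card_colorings_add_isolated fin card_colorings_path_graph)
  have wG: "real (card (colorings (?G (p + 1)) m)) / fact m = real m * w m" for m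
    by (simp add: w n card_colorings_add_isolated fin card_colorings_path_graph)
  have wH: "real (card (colorings ?H m)) / fact m = real m * w m - w m" for m
  proof -
    have "card (colorings ?H m) = m * (m - 1) ^ Suc k * m ^ p"
      using card_colorings_path_graph[of "Suc k"] by (simp add: n card_colorings_add_isolated fin)
    \<comment> \<open>The case \<open>m = 0\<close> is separate since natural \<open>m - 1\<close>
      is then 0 but \<open>real m - 1\<close> is -1; both sides vanish.\<close>
    moreover have "real (m * (m - 1) ^ Suc k * m ^ p) = (real m - 1) * real (m * (m - 1) ^ k * m ^ p)"
      by (cases m) (simp_all add: algebra_simps)
    ultimately show ?thesis 
      by (simp only: w left_diff_distrib diff_divide_distrib mult_1_left times_divide_eq_right)
  qed
  \<comment> \<open>These turn out to be the moments of \<open>w\<close> of orders 0, 1 and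
    2.\<close>
  define M0 M1 M2 where "M0 = exp 1 * real (total_colorings (?G p))"
    and "M1 = exp 1 * real (total_colorings (?G (p + 1)))"
    and "M2 = exp 1 * (real (total_colorings (?G (p + 1))) + real (total_colors (?G (p + 1))))"
  have M0: "w sums M0"
    using sums_colorings[OF fin(2)[of n p]] by (simp add: M0_def w_def[abs_def])
  have M1: "(\<lambda>m. real m * w m) sums M1"
    using sums_colorings[OF fin(2)[of n "p + 1"]] unfolding wG M1_def .
  have M2: "(\<lambda>m. (real m)\<^sup>2 * w m) sums M2"
    using sums_id_times_colorings[OF fin(2)[of n "p + 1"]]
    unfolding wG M2_def by (simp add: power2_eq_square mult.assoc)
  have H0: "exp 1 * real (total_colorings ?H) = M1 - M0"
    using sums_colorings[OF fin(2)[of "n + 1" p]] sums_diff[OF M1 M0]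
    unfolding wH by (rule sums_unique2)
  have "(\<lambda>m. real m * (real m * w m - w m)) sums (M2 - M1)"
    using sums_diff[OF M2 M1] by (simp add: power2_eq_square algebra_simps)
  then have H1: "exp 1 * (real (total_colorings ?H) + real (total_colors ?H)) = M2 - M1"
    using sums_id_times_colorings[OF fin(2)[of "n + 1" p]] unfolding wH by (intro sums_unique2)
  have nonneg: "w m \<ge> 0" for m
    by (simp add: w)
  \<comment> \<open>The weight at 0 is always 0 and the weight at 1 vanishes for
    \<open>k > 0\<close>, so 2 and 3 are the first two points that work for every
    \<open>k\<close>.\<close>
  have pos: "w 2 > 0" "w 3 > 0"
    by (simp_all add: w)
  have CS: "M1\<^sup>2 < M0 * M2"
    using M0 M1 M2 nonneg pos by (rule strict_Cauchy_Schwarz_moments) simp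
  have M1_pos: "M1 > 0"
    using suminf_pos2[of "\<lambda>m. real m * w m" 2] M1 nonneg pos by (simp add: sums_iff)
  \<comment> \<open>Nonnegative even at \<open>m = 0\<close>, being a coloring count of
    \<open>?H\<close> divided by a factorial.\<close>
  have diff_nonneg: "real m * w m - w m \<ge> 0" for m
    unfolding wH[symmetric] by simp
  have diff_pos: "M1 - M0 > 0"
    using suminf_pos2[of "\<lambda>m. real m * w m - w m" 2] sums_diff[OF M1 M0] diff_nonneg pos
    by (simp add: sums_iff)
  \<comment> \<open>Adding 1 to both averages turns them into ratios of the available series
    values.\<close>
  have avg: "avg_colors G + 1 =
      exp 1 * (real (total_colorings G) + real (total_colors G)) / (exp 1 * real (total_colorings G))"
    if "exp 1 * real (total_colorings G) > 0" for G :: "(nat + nat) pair_pre_digraph"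
    using that by (simp add: avg_colors_def field_simps zero_less_mult_iff)
  have "avg_colors (?G (p + 1)) + 1 = M2 / M1"
    using avg[of "?G (p + 1)"] M1_pos by (simp add: M1_def M2_def)
  \<comment> \<open>Clearing the positive denominators and cancelling \<open>M1 * M2\<close> leaves
    exactly \<open>CS\<close>.\<close>
  also have "\<dots> < (M2 - M1) / (M1 - M0)"
    using CS M1_pos diff_pos by (simp add: divide_simps power2_eq_square algebra_simps)
  also have "\<dots> = avg_colors ?H + 1"
    using avg[of ?H, unfolded H0 H1, OF diff_pos] by simp
  finally show ?thesis by simp
qed

end
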